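(* Let $X=(X,\|\cdot\|)$ be a Banach space and let $(A_n)_{n\in\mathbb{Z}}$ be a sequence of invertible bounded linear operators on $X$ that admits a generalized exponential dichotomy, with subspaces $S(n),U(n)$ and exponent $\lambda>0$. Assume that there exist $\rho>0$ and numbers $C_{m,n}\ge 1$, $m,n\in\mathbb{Z}$, such that $$\lim_{m\to\pm\infty}\frac1m\log C_{m,n}=0\quad\text{for every } n\in\mathbb{Z},$$ $$\|\mathcal{A}(m,n)x\|\le C_{m,n}e^{\rho|m-n|}\|x\|\quad\text{for every } x\in X \text{ and } m,n\in\mathbb{Z}.$$ Let $\alpha_0=\lambda/\rho$, let $\alpha\in(0,\alpha_0)$, and take $\varepsilon>0$ such that $\alpha(\rho+\varepsilon)<\lambda$. For $n\in\mathbb{Z}$ set $$C_n=C_n(\varepsilon):=\sup_{m\in\mathbb{Z}}\bigl(C_{m,n}e^{-\varepsilon|m-n|}\bigr),$$ which is finite. Let $(f_n)_{n\in\mathbb{Z}}$ be a sequence of maps $f_n\colon X\to X$ such that $A_n+f_n$ is a homeomorphism for each $n\in\mathbb{Z}$ and $\sup_{n\in\mathbb{Z}}\|f_n\|_\infty<+\infty$. Moreover, suppose that there exists $c>0$ such that $$\|f_n(x)-f_n(y)\|\le C_{n+1}^{-1}c\|x-y\|\quad\text{for every } x,y\in X \text{ and } n\in\mathbb{Z}.$$ Then, whenever $c>0$ is sufficiently small, the conjugacies $H_n$ and their inverses $H_n^{-1}$, $n\in\mathbb{Z}$, are $\alpha$-Hölder continuous when restricted to any bounded subset of $X$. Here $(H_n)_{n\in\mathbb{Z}}$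 is the sequence of homeomorphisms of $X$ (which exists and is unique for $c$ sufficiently small) such that $H_{n+1}\circ A_n=(A_n+f_n)\circ H_n$ for all $n\in\mathbb{Z}$, $\sup_{n\in\mathbb{Z}}\|H_n-\mathrm{Id}\|_\infty<+\infty$, and $H_n(x)-x\in S(n)+A_n^{-1}U(n+1)$ for all $n\in\mathbb{Z}$ and $x\in X$.
   Context: For a map $g\colon X\to X$, $\|g\|_\infty:=\sup\{\|g(x)\|: x\in X\}$. A map $g$ is $\alpha$-Hölder continuous on a set $B\subset X$ if there is $L\ge 0$ (possibly depending on $g$ and $B$) with $\|g(x)-g(y)\|\le L\|x-y\|^\alpha$ for all $x,y\in B$. Linear cocycle: for a sequence $(A_n)_{n\in\mathbb{Z}}$ of invertible bounded linear operators on $X$, define $\mathcal{A}(m,n)=A_{m-1}\cdots A_n$ if $m>n$, $\mathcal{A}(n,n)=\mathrm{Id}$, and $\mathcal{A}(m,n)=A_m^{-1}\cdots A_{n-1}^{-1}$ if $m<n$. Generalized exponential dichotomy: $(A_n)_{n\in\mathbb{Z}}$ admits a generalized exponential dichotomy if - for each $n\in\mathbb{Z}$ there are closed subspaces $S(n)$ and $U(n)$ of $X$ with $X=S(n)\oplus U(n)$; - for each $n\in\mathbb{Z}$, $A_nS(n)\subset S(n+1)$ and $A_n^{-1}U(n+1)\subset U(n)$ (inclusions, not necessarily equalities); - there exist $D,\lambda>0$ such that $\|\mathcal{A}(m,n)x\|\le De^{-\lambda(m-n)}\|x\|$ for $x\in S(n)$ and $m\ge n$, and $\|\mathcal{A}(m,n)x\|\le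 De^{-\lambda(n-m)}\|x\|$ for $x\in U(n)$ and $m\le n$; - $\sup_{n\in\mathbb{Z}}\|P_n\|<\infty$, where $P_n\colon X\to S(n)$ is the projection associated with the decomposition $X=S(n)\oplus U(n)$. The exponent $\lambda$ in the claim is the one appearing in this definition.
   Formalization: The exponent is additionally assumed to satisfy α ≤ 1: λ/ρ can exceed 1 under the stated hypotheses, and for α > 1 the claim fails on every nonzero X (e.g. f_n = 0, H_n = Id), since no homeomorphism of X is α-Hölder on bounded sets. *)

theory Defs
  imports "HOL-Analysis.Analysis"
begin

text \<open>
  A complex Banach space is covered by its underlying real structure, so the phase space is an
  arbitrary type of class \<open>banach\<close>.  Operators are plain functions, so that inverses are written
  with \<open>inv\<close>.
\<close>

definition invertible_op :: "('a::real_normed_vector \<Rightarrow> 'a) \<Rightarrow> bool" where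
  "invertible_op T \<longleftrightarrow> bounded_linear T \<and> bij T \<and> bounded_linear (inv T)"

text \<open>\<open>fwd_prod A n k\<close> is \<open>A (n + k - 1) \<circ> \<dots> \<circ> A n\<close> and
  \<open>bwd_prod A n k\<close> is \<open>inv (A (n - k)) \<circ> \<dots> \<circ> inv (A (n - 1))\<close>.\<close>

primrec fwd_prod :: "(int \<Rightarrow> 'a \<Rightarrow> 'a) \<Rightarrow> int \<Rightarrow> nat \<Rightarrow> 'a \<Rightarrow> 'a" where
  "fwd_prod A n 0 = id"
| "fwd_prod A n (Suc k) = A (n + int k) \<circ> fwd_prod A n k"

primrec bwd_prod :: "(int \<Rightarrow> 'a \<Rightarrow> 'a) \<Rightarrow> int \<Rightarrow> nat \<Rightarrow> 'a \<Rightarrow> 'a" where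
  "bwd_prod A n 0 = id"
| "bwd_prod A n (Suc k) = inv (A (n - int (Suc k))) \<circ> bwd_prod A n k"

definition cocycle :: "(int \<Rightarrow> 'a \<Rightarrow> 'a) \<Rightarrow> int \<Rightarrow> int \<Rightarrow> 'a \<Rightarrow> 'a" where
  "cocycle A m n = (if n \<le> m then fwd_prod A n (nat (m - n)) else bwd_prod A n (nat (n - m)))"

definition closed_direct_sum :: "'a::real_normed_vector set \<Rightarrow> 'a set \<Rightarrow> bool" where
  "closed_direct_sum S U \<longleftrightarrow>
     subspace S \<and> closed S \<and> subspace U \<and> closed U \<and> S \<inter> U = {0} \<and> S + U = UNIV"

definition proj_along :: "'a::real_normed_vector set \<Rightarrow> 'a set \<Rightarrow> 'a \<Rightarrow> 'a" where
  "proj_along S U x = (THE s. s \<in> S \<and> x - s \<in> U)"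

text \<open>In the last conjunct, finiteness of the supremum of the operator norms of the projections
  is written as a common operator bound, because \<open>onorm\<close> is unspecified on maps that have not
  been shown to be bounded.\<close>

definition gen_exp_dichotomy ::
  "(int \<Rightarrow> 'a::real_normed_vector \<Rightarrow> 'a) \<Rightarrow> (int \<Rightarrow> 'a set) \<Rightarrow> (int \<Rightarrow> 'a set) \<Rightarrow> real \<Rightarrow> bool" where
  "gen_exp_dichotomy A S U lam \<longleftrightarrow>
     (\<forall>n. closed_direct_sum (S n) (U n)) \<and>
     (\<forall>n. A n ` S n \<subseteq> S (n + 1) \<and> inv (A n) ` U (n + 1) \<subseteq> U n) \<and>
     lam > 0 \<and>
     (\<exists>D>0.
        (\<forall>m n x. x \<in> S n \<and> n \<le> m \<longrightarrow>
           norm (cocycle A m n x) \<le> D * exp (- lam * real_of_int (m - n)) * norm x) \<and>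
        (\<forall>m n x. x \<in> U n \<and> m \<le> n \<longrightarrow>
           norm (cocycle A m n x) \<le> D * exp (- lam * real_of_int (n - m)) * norm x)) \<and>
     (\<exists>K. \<forall>n x. norm (proj_along (S n) (U n) x) \<le> K * norm x)"

definition sup_norm :: "('a \<Rightarrow> 'b::real_normed_vector) \<Rightarrow> ennreal" where
  "sup_norm g = (SUP x. ennreal (norm (g x)))"

definition holder_on :: "real \<Rightarrow> 'a::real_normed_vector set \<Rightarrow> ('a \<Rightarrow> 'b::real_normed_vector) \<Rightarrow> bool" where
  "holder_on a B g \<longleftrightarrow>
     (\<exists>L\<ge>0. \<forall>x\<in>B. \<forall>y\<in>B. norm (g x - g y) \<le> L * norm (x - y) powr a)"

definition weight_sup :: "(int \<Rightarrow> int \<Rightarrow> real) \<Rightarrow> real \<Rightarrow> int \<Rightarrow> real" where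
  "weight_sup C eps n = (SUP m. C m n * exp (- eps * real_of_int \<bar>m - n\<bar>))"

definition conjugacy ::
  "(int \<Rightarrow> 'a::real_normed_vector \<Rightarrow> 'a) \<Rightarrow> (int \<Rightarrow> 'a set) \<Rightarrow> (int \<Rightarrow> 'a set) \<Rightarrow>
   (int \<Rightarrow> 'a \<Rightarrow> 'a) \<Rightarrow> (int \<Rightarrow> 'a \<Rightarrow> 'a) \<Rightarrow> bool" where
  "conjugacy A S U f H \<longleftrightarrow>
     (\<forall>n. homeomorphic_map euclidean euclidean (H n)) \<and>
     (\<forall>n. H (n + 1) \<circ> A n = (\<lambda>x. A n x + f n x) \<circ> H n) \<and>
     (SUP n. sup_norm (\<lambda>x. H n x - x)) < \<infinity> \<and>
     (\<forall>n x. H n x - x \<in> S n + inv (A n) ` U (n + 1))"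

end

theory Submission imports Defs begin

text \<open>The idea is to compare whole orbits.  Write a conjugacy as the identity plus a displacement.
  Along an orbit \<open>w\<close> of one system, the displacements \<open>q n\<close> that turn \<open>w\<close> into an orbit \<open>w + q\<close> of
  another one are the solutions of \<open>q (n + 1) = A n (q n) + (g n (w n + q n) - f n (w n))\<close>, where \<open>f\<close>
  and \<open>g\<close> are the perturbations of the linear cocycle defining the two systems.  The dichotomy
  provides a Green operator which solves such equations with bounded forcing.  In a generalized
  dichotomy bounded solutions need not be unique, but they are unique within the subspaces
  \<open>S n + inv (A n) ` U (n + 1)\<close> (\<open>bsol_zero\<close>); this explains the third condition on the conjugacies.
  For small Lipschitz constants the contraction principle yields exactly one bounded \<open>q\<close> in these
  subspaces (\<open>nonlinear_bsol\<close>), hence exactly one shadowing map from the first system to the second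
  (\<open>semiconj_ex1\<close>).

  As the two systems enter symmetrically, the same result gives the map \<open>H\<close> from the linear
  cocycle to its perturbation (\<open>f = 0\<close>), the map \<open>G\<close> backwards (\<open>g = 0\<close>), and, applied to a system
  and itself, the identities \<open>G \<circ> H = id\<close> and \<open>H \<circ> G = id\<close>.

  For regularity, consider two orbits \<open>w\<close>, \<open>w'\<close> of the first system that start at time \<open>n\<close> at
  distance \<open>\<delta>\<close>.  They separate at most like \<open>exp ((\<rho> + \<epsilon> + \<theta>) * \<bar>k - n\<bar>) * \<delta>\<close>, with \<open>\<theta>\<close> as small as
  desired: the factor \<open>inverse (weight_sup C \<epsilon> (n + 1))\<close> in the Lipschitz condition compensates exactly the
  nonuniformity of the growth bound, and a Gronwall argument applies (\<open>perturbed_growth\<close>).  A bounded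
  Lipschitz perturbation changes from \<open>w k\<close> to \<open>w' k\<close> by at most a constant times the \<open>\<alpha>\<close>-th power of
  their distance, and this grows at a rate less than \<open>lam\<close> when \<open>\<alpha> * (\<rho> + \<epsilon> + \<theta>) < lam\<close>.  The Green
  operator is bounded for such exponential weights, and so the displacements at time \<open>n\<close> differ by at
  most a constant times \<open>\<delta> powr \<alpha>\<close> (\<open>semiconj_displacement_holder\<close>).  Continuity of \<open>H\<close> and \<open>G\<close>, and
  thereby the homeomorphism property, follows from these Hoelder estimates.\<close>

section \<open>Cocycles of bijections\<close>

lemma cocycle_self [simp]: "cocycle T n n x = x"
  by (simp add: cocycle_def)

lemma cocycle_step:
  assumes "\<And>n. bij (T n)"
  shows "cocycle T (m + 1) n x = T m (cocycle T m n x)"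
proof (cases "n \<le> m")
  case True
  then have "nat (m + 1 - n) = Suc (nat (m - n))" by simp
  with True show ?thesis by (simp add: cocycle_def)
next
  case False
  then have *: "nat (n - m) = Suc (nat (n - (m + 1)))" by simp
  have "T m (inv (T m) y) = y" for y
    using assms by (simp add: bij_is_surj surj_f_inv_f)
  moreover from False have "n - int (Suc (nat (n - (m + 1)))) = m" by simp
  ultimately have "T m (cocycle T m n x) = bwd_prod T n (nat (n - (m + 1))) x"
    using False unfolding cocycle_def * by simp
  moreover have "cocycle T (m + 1) n x = bwd_prod T n (nat (n - (m + 1))) x"
    using False by (cases "n = m + 1") (auto simp: cocycle_def)
  ultimately show ?thesis by simp
qed

lemma orbit_eq_cocycle:
  assumes T: "\<And>n. bij (T n)" and w: "\<And>k. w (k + 1) = T k (w k)"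
  shows "w m = cocycle T m n (w n)"
proof (induction m rule: int_induct [where k = n])
  case (step1 i)
  then show ?case using cocycle_step [OF T] w by simp
next
  case (step2 i)
  from w [of "i - 1"] step2 cocycle_step [of T "i - 1" n "w n", OF T]
  have "T (i - 1) (w (i - 1)) = T (i - 1) (cocycle T (i - 1) n (w n))" by simp
  then show ?case using T by (simp add: bij_is_inj inj_eq)
qed simp

lemma cocycle_comp:
  assumes "\<And>n. bij (T n)"
  shows "cocycle T m k (cocycle T k n x) = cocycle T m n x"
  using orbit_eq_cocycle [of T "\<lambda>m. cocycle T m n x"] cocycle_step assms by metis

section \<open>Projections along a closed splitting\<close>

lemma proj_along_decomp:
  assumes "closed_direct_sum S U"
  shows "proj_along S U x \<in> S" "x - proj_along S U x \<in> U"
proof -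
  from assms have sub: "subspace S" "subspace U" and 0: "S \<inter> U = {0}" and "x \<in> S + U"
    by (auto simp: closed_direct_sum_def)
  then obtain s u where "s \<in> S" "u \<in> U" "x = s + u" by (elim set_plus_elim)
  then have s: "s \<in> S" "x - s \<in> U" by simp_all
  have "t = s" if "t \<in> S" "x - t \<in> U" for t
  proof -
    have "t - s \<in> S" by (rule subspace_diff [OF sub(1) that(1) s(1)])
    moreover have "t - s \<in> U" using subspace_diff [OF sub(2) s(2) that(2)] by simp
    ultimately have "t - s \<in> {0}" unfolding 0 [symmetric] by (rule IntI)
    then show "t = s" by simp
  qed
  with s have "\<exists>!s. s \<in> S \<and> x - s \<in> U" by blast
  then have "proj_along S U x \<in> S \<and> x - proj_along S U x \<in> U"
    unfolding proj_along_def by (rule theI')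
  then show "proj_along S U x \<in> S" "x - proj_along S U x \<in> U" by simp_all
qed

lemma proj_along_unique:
  assumes D: "closed_direct_sum S U" and "s \<in> S" "u \<in> U"
  shows "proj_along S U (s + u) = s"
proof -
  from D have sub: "subspace S" "subspace U" and 0: "S \<inter> U = {0}"
    by (auto simp: closed_direct_sum_def)
  let ?p = "proj_along S U (s + u)"
  have "?p - s \<in> S" by (rule subspace_diff [OF sub(1) proj_along_decomp(1) [OF D] \<open>s \<in> S\<close>])
  moreover have "u - (s + u - ?p) \<in> U"
    using subspace_diff [OF sub(2) \<open>u \<in> U\<close> proj_along_decomp(2) [OF D, of "s + u"]] .
  then have "?p - s \<in> U" by simp
  ultimately have "?p - s \<in> {0}" unfolding 0 [symmetric] by (rule IntI)
  then show ?thesis by simp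
qed

section \<open>Completeness and summation\<close>

lemma geometric_majorant:
  fixes a :: "nat \<Rightarrow> 'a::banach"
  assumes a: "\<And>j. norm (a j) \<le> R * q ^ j" and q: "0 \<le> q" "q < 1"
  shows "summable a" "norm (\<Sum>j. a j) \<le> R / (1 - q)"
proof -
  from q have s: "summable (\<lambda>j. R * q ^ j)" by (intro summable_mult summable_geometric) auto
  then have n: "summable (\<lambda>j. norm (a j))"
    by (rule summable_comparison_test') (use a in auto)
  then show "summable a" by (rule summable_norm_cancel)
  have "norm (\<Sum>j. a j) \<le> (\<Sum>j. norm (a j))" by (rule summable_norm [OF n])
  also have "\<dots> \<le> (\<Sum>j. R * q ^ j)" by (rule suminf_le [OF a n s])
  also have "\<dots> = R / (1 - q)" using q by (simp add: suminf_mult suminf_geometric)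
  finally show "norm (\<Sum>j. a j) \<le> R / (1 - q)" .
qed

lemma closed_subspace_suminf:
  fixes a :: "nat \<Rightarrow> 'a::banach"
  assumes V: "subspace V" "closed V" and "\<And>j. a j \<in> V" "summable a"
  shows "(\<Sum>j. a j) \<in> V"
proof (rule closed_sequentially [OF V(2)])
  show "(\<Sum>j<n. a j) \<in> V" for n using assms by (intro subspace_sum) auto
  show "(\<lambda>n. \<Sum>j<n. a j) \<longlonglongrightarrow> (\<Sum>j. a j)" using assms by (simp add: summable_LIMSEQ)
qed

text \<open>The completeness is needed for the integers, with their discrete topology, as domain.\<close>

lemma complete_bcontfun: "complete (UNIV :: ('b::topological_space \<Rightarrow>\<^sub>C 'c::complete_space) set)"
proof (rule completeI)
  fix F :: "nat \<Rightarrow> 'b \<Rightarrow>\<^sub>C 'c"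
  assume F: "Cauchy F"
  have "\<forall>e>0. \<exists>N. \<forall>m n x. N \<le> m \<and> N \<le> n \<and> True \<longrightarrow> dist (F m x) (F n x) < e"
    using F unfolding Cauchy_def by (meson dist_fun_lt_imp_dist_val_lt)
  then obtain l where "\<forall>e>0. \<exists>N. \<forall>n x. N \<le> n \<and> True \<longrightarrow> dist (F n x) (l x) < e"
    using uniformly_convergent_eq_cauchy [of "\<lambda>_. True" "\<lambda>n. apply_bcontfun (F n)"] by blast
  then have "uniform_limit UNIV (\<lambda>n. apply_bcontfun (F n)) l sequentially"
    by (simp add: uniform_limit_sequentially_iff)
  from uniform_limit_bcontfunE [OF this] show "\<exists>l\<in>UNIV. F \<longlonglongrightarrow> l" by auto
qed

section \<open>Green operator of a generalized dichotomy\<close>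

text \<open>Each of the two families of subspaces is carried into itself in its contracting time
  direction only, so that \<open>A n ` S n\<close> may be smaller than \<open>S (n + 1)\<close> and orbits bounded in both
  directions need not vanish.\<close>

locale dichotomy =
  fixes A :: "int \<Rightarrow> 'a::banach \<Rightarrow> 'a" and S U :: "int \<Rightarrow> 'a set" and lam D K :: real
  assumes inv_A: "\<And>n. invertible_op (A n)"
    and splitting: "\<And>n. closed_direct_sum (S n) (U n)"
    and A_S: "\<And>n. A n ` S n \<subseteq> S (n + 1)"
    and A_U: "\<And>n. inv (A n) ` U (n + 1) \<subseteq> U n"
    and lam_pos: "lam > 0" and D_pos: "D > 0" and K_nonneg: "K \<ge> 0"
    and stable: "\<And>m n x. x \<in> S n \<Longrightarrow> n \<le> m \<Longrightarrow>
      norm (cocycle A m n x) \<le> D * exp (- lam * real_of_int (m - n)) * norm x"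
    and unstable: "\<And>m n x. x \<in> U n \<Longrightarrow> m \<le> n \<Longrightarrow>
      norm (cocycle A m n x) \<le> D * exp (- lam * real_of_int (n - m)) * norm x"
    and proj_bound: "\<And>n x. norm (proj_along (S n) (U n) x) \<le> K * norm x"
begin

abbreviation "P n \<equiv> proj_along (S n) (U n)"

text \<open>A bounded orbit of the linear cocycle need not vanish, but it does once all of its entries
  lie in \<open>Z n\<close>: by \<open>Z n\<close>, not only the stable component of a vector but also its unstable
  component is carried by \<open>A n\<close> into the corresponding subspace at time \<open>n + 1\<close>.\<close>

definition Z :: "int \<Rightarrow> 'a set" where "Z n = S n + inv (A n) ` U (n + 1)"

text \<open>The bounded solution of \<open>y (n + 1) = A n (y n) + g n\<close> collects, at time \<open>n\<close>, the stable
  parts of all past inputs transported forward and, with the opposite sign, the unstable parts of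
  the present and future inputs transported backward.  The two directions of summation are kept as
  separate series over the naturals.\<close>

definition stable_term :: "(int \<Rightarrow> 'a) \<Rightarrow> int \<Rightarrow> nat \<Rightarrow> 'a" where
  "stable_term g n j = cocycle A n (n - int j) (P (n - int j) (g (n - int j - 1)))"

definition unstable_term :: "(int \<Rightarrow> 'a) \<Rightarrow> int \<Rightarrow> nat \<Rightarrow> 'a" where
  "unstable_term g n j = cocycle A n (n + 1 + int j)
     (g (n + int j) - P (n + 1 + int j) (g (n + int j)))"

definition green :: "(int \<Rightarrow> 'a) \<Rightarrow> int \<Rightarrow> 'a" where
  "green g n = (\<Sum>j. stable_term g n j) - (\<Sum>j. unstable_term g n j)"

text \<open>A bound for the norm of the Green operator on sequences growing at most like \<open>exp (\<mu> * \<bar>k - n0\<bar>)\<close>,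
  uniformly in the base point \<open>n0\<close>.  It is the sum of two geometric series of ratio
  \<open>exp (- (lam - \<mu>))\<close>, which is why \<open>\<mu> < lam\<close> is the threshold throughout.\<close>

definition kappa :: "real \<Rightarrow> real" where
  "kappa \<mu> = D * (2 * K + 1) * exp \<mu> / (1 - exp (- (lam - \<mu>)))"

lemma bij_A: "bij (A n)" and linear_A: "bounded_linear (A n)"
  and linear_inv_A: "bounded_linear (inv (A n))"
  using inv_A by (auto simp: invertible_op_def)

lemma A_inv [simp]: "A n (inv (A n) x) = x" and inv_A_A [simp]: "inv (A n) (A n x) = x"
  using bij_A by (auto simp: bij_is_surj surj_f_inv_f bij_is_inj inv_f_f)

lemma subspace_S: "subspace (S n)" and subspace_U: "subspace (U n)"
  and closed_S: "closed (S n)" and closed_U: "closed (U n)"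
  using splitting by (auto simp: closed_direct_sum_def)

lemmas cocycle_A_step = cocycle_step [of A, OF bij_A]

lemma cocycle_S:
  assumes "x \<in> S n" "n \<le> m" shows "cocycle A m n x \<in> S m"
  using assms(2)
proof (induction m rule: int_ge_induct)
  case (step i)
  then show ?case using A_S cocycle_A_step by auto
qed (use assms in simp)

lemma cocycle_U:
  assumes "x \<in> U n" "m \<le> n" shows "cocycle A m n x \<in> U m"
  using assms(2)
proof (induction m rule: int_le_induct)
  case (step i)
  have "cocycle A (i - 1) n x = inv (A (i - 1)) (cocycle A i n x)"
    using cocycle_A_step [of "i - 1" n x] by simp
  then show ?case using step A_U [of "i - 1"] by auto
qed (use assms in simp)

lemma subspace_Z: "subspace (Z n)"
proof -
  have "subspace (inv (A n) ` U (n + 1))"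
    using linear_inv_A subspace_U
    by (intro linear_subspace_image) (auto simp: bounded_linear.linear)
  moreover have "Z n = {x + y |x y. x \<in> S n \<and> y \<in> inv (A n) ` U (n + 1)}"
    unfolding Z_def set_plus_def by blast
  ultimately show ?thesis using subspace_sums [OF subspace_S] by simp
qed

lemma exp_neg_gap_less_1:
  assumes "\<mu> < lam" shows "exp (- (lam - \<mu>)) < (1::real)"
  using assms by simp

lemma kappa_pos: "\<mu> < lam \<Longrightarrow> 0 < kappa \<mu>"
  unfolding kappa_def using D_pos K_nonneg
  by (intro divide_pos_pos mult_pos_pos) auto

text \<open>An input at distance \<open>j\<close> from the time of observation carries a weight that is larger, up to
  the constant \<open>exp \<mu>\<close>, by a factor \<open>exp (\<mu> * j)\<close> at most; the contraction \<open>exp (- lam * j)\<close> absorbs it.  The extra unit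
  in \<open>int j + 1\<close> accounts for the input \<open>g (n - j - 1)\<close> arriving at time \<open>n - j\<close>.\<close>

lemma exp_weight_shift:
  fixes n m n0 :: int and \<mu> :: real
  assumes "0 \<le> \<mu>" "\<bar>m - n\<bar> \<le> int j + 1"
  shows "exp (\<mu> * \<bar>m - n0\<bar>) \<le> exp \<mu> * exp (\<mu> * \<bar>n - n0\<bar>) * exp (\<mu> * j)"
proof -
  have "\<bar>m - n0\<bar> \<le> 1 + \<bar>n - n0\<bar> + int j" using assms(2) by linarith
  then have "real_of_int \<bar>m - n0\<bar> \<le> 1 + real_of_int \<bar>n - n0\<bar> + real j" by linarith
  then have "\<mu> * \<bar>m - n0\<bar> \<le> \<mu> * (1 + real_of_int \<bar>n - n0\<bar> + real j)"
    by (rule mult_left_mono [OF _ assms(1)])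
  then show ?thesis by (simp add: algebra_simps flip: exp_add)
qed

context
  fixes g :: "int \<Rightarrow> 'a" and \<mu> N :: real and n0 :: int
  assumes g: "\<And>k. norm (g k) \<le> N * exp (\<mu> * \<bar>k - n0\<bar>)" and mu: "0 \<le> \<mu>" "\<mu> < lam"
begin

lemma N_nonneg: "0 \<le> N"
  using order_trans [OF norm_ge_zero g [of n0]] by simp

lemma stable_term_bound:
  "norm (stable_term g n j) \<le>
    (D * K * N * exp \<mu> * exp (\<mu> * \<bar>n - n0\<bar>)) * exp (- (lam - \<mu>)) ^ j"
proof -
  let ?m = "n - int j - 1"
  have "norm (stable_term g n j) \<le> D * exp (- lam * j) * norm (P (n - int j) (g ?m))"
    unfolding stable_term_def
    using stable [OF proj_along_decomp(1) [OF splitting], of "n - int j" n "g ?m"] by simp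
  also have "\<dots> \<le> D * exp (- lam * j) * (K * (N * exp (\<mu> * \<bar>?m - n0\<bar>)))"
    using D_pos K_nonneg g [of ?m]
    by (intro mult_left_mono order_trans [OF proj_bound]) auto
  also have "\<dots> \<le> D * exp (- lam * j) *
      (K * (N * (exp \<mu> * exp (\<mu> * \<bar>n - n0\<bar>) * exp (\<mu> * j))))"
    using D_pos K_nonneg N_nonneg
    by (intro mult_left_mono exp_weight_shift [OF mu(1)]) auto
  also have "\<dots> = (D * K * N * exp \<mu> * exp (\<mu> * \<bar>n - n0\<bar>)) * exp (- (lam - \<mu>)) ^ j"
    by (simp add: algebra_simps flip: exp_add exp_of_nat_mult)
  finally show ?thesis .
qed

lemma unstable_term_bound:
  "norm (unstable_term g n j) \<le>
    (D * (K + 1) * N * exp \<mu> * exp (\<mu> * \<bar>n - n0\<bar>)) * exp (- (lam - \<mu>)) ^ j"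
proof -
  let ?m = "n + int j"
  let ?q = "g ?m - P (n + 1 + int j) (g ?m)"
  have "norm (unstable_term g n j) \<le> D * exp (- lam * (1 + real j)) * norm ?q"
    unfolding unstable_term_def
    using unstable [OF proj_along_decomp(2) [OF splitting], of n "n + 1 + int j" "g ?m"]
    by simp
  also have "\<dots> \<le> D * exp (- lam * j) * ((K + 1) * (N * exp (\<mu> * \<bar>?m - n0\<bar>)))"
  proof (intro mult_mono)
    have "norm ?q \<le> norm (g ?m) + K * norm (g ?m)"
      by (rule order_trans [OF norm_triangle_ineq4]) (simp add: proj_bound)
    also have "\<dots> = (K + 1) * norm (g ?m)" by (simp add: algebra_simps)
    also have "\<dots> \<le> (K + 1) * (N * exp (\<mu> * \<bar>?m - n0\<bar>))"
      using K_nonneg by (intro mult_left_mono g) simp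
    finally show "norm ?q \<le> (K + 1) * (N * exp (\<mu> * \<bar>?m - n0\<bar>))" .
  qed (use D_pos lam_pos in \<open>auto simp: algebra_simps\<close>)
  also have "\<dots> \<le> D * exp (- lam * j) *
      ((K + 1) * (N * (exp \<mu> * exp (\<mu> * \<bar>n - n0\<bar>) * exp (\<mu> * j))))"
    using D_pos K_nonneg N_nonneg
    by (intro mult_left_mono exp_weight_shift [OF mu(1)]) auto
  also have "\<dots> = (D * (K + 1) * N * exp \<mu> * exp (\<mu> * \<bar>n - n0\<bar>)) * exp (- (lam - \<mu>)) ^ j"
    by (simp add: algebra_simps flip: exp_add exp_of_nat_mult)
  finally show ?thesis .
qed

lemma summable_stable_term: "summable (stable_term g n)"
  using geometric_majorant(1) [OF stable_term_bound _ exp_neg_gap_less_1] mu by simp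

lemma summable_unstable_term: "summable (unstable_term g n)"
  using geometric_majorant(1) [OF unstable_term_bound _ exp_neg_gap_less_1] mu by simp

lemma green_bound: "norm (green g n) \<le> kappa \<mu> * N * exp (\<mu> * \<bar>n - n0\<bar>)"
proof -
  have "norm (green g n) \<le> norm (\<Sum>j. stable_term g n j) + norm (\<Sum>j. unstable_term g n j)"
    unfolding green_def by (rule norm_triangle_ineq4)
  also have "\<dots> \<le> (D * K * N * exp \<mu> * exp (\<mu> * \<bar>n - n0\<bar>)) / (1 - exp (- (lam - \<mu>)))
      + (D * (K + 1) * N * exp \<mu> * exp (\<mu> * \<bar>n - n0\<bar>)) / (1 - exp (- (lam - \<mu>)))"
    using mu by (intro add_mono geometric_majorant(2) stable_term_bound unstable_term_bound exp_neg_gap_less_1) auto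
  also have "\<dots> = kappa \<mu> * N * exp (\<mu> * \<bar>n - n0\<bar>)"
    unfolding kappa_def by (simp add: field_simps flip: add_divide_distrib)
  finally show ?thesis .
qed

text \<open>Shifting both series by one index produces the two missing terms, and these are the stable
  and the unstable part of \<open>g n\<close>.\<close>

lemma green_step: "green g (n + 1) = A n (green g n) + g n"
proof -
  have s: "stable_term g (n + 1) (Suc j) = A n (stable_term g n j)" for j
  proof -
    have "n + 1 - int (Suc j) = n - int j" by simp
    then show ?thesis unfolding stable_term_def cocycle_A_step by simp
  qed
  have u: "A n (unstable_term g n (Suc j)) = unstable_term g (n + 1) j" for j
  proof -
    have e: "n + 1 + int (Suc j) = n + 1 + 1 + int j" "n + int (Suc j) = n + 1 + int j"
      by simp_all
    show ?thesis unfolding unstable_term_def cocycle_A_step [symmetric] e ..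
  qed
  have "(\<Sum>j. stable_term g (n + 1) j) = A n (\<Sum>j. stable_term g n j) + P (n + 1) (g n)"
    unfolding bounded_linear.suminf [OF linear_A summable_stable_term] s [symmetric]
    using suminf_split_head [OF summable_stable_term, of "n + 1"]
    by (simp add: stable_term_def [of _ _ 0])
  moreover have "A n (\<Sum>j. unstable_term g n j) =
      (\<Sum>j. unstable_term g (n + 1) j) + (g n - P (n + 1) (g n))"
  proof -
    have "A n (\<Sum>j. unstable_term g n j) = (\<Sum>j. A n (unstable_term g n j))"
      by (rule bounded_linear.suminf [OF linear_A summable_unstable_term])
    also have "\<dots> = (\<Sum>j. A n (unstable_term g n (Suc j))) + A n (unstable_term g n 0)"
      using suminf_split_head [OF bounded_linear.summable [OF linear_A summable_unstable_term]]
      by (simp add: algebra_simps)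
    also have "A n (unstable_term g n 0) = g n - P (n + 1) (g n)"
      by (simp add: unstable_term_def flip: cocycle_A_step)
    finally show ?thesis by (simp add: u)
  qed
  ultimately show ?thesis
    unfolding green_def by (simp add: linear_diff bounded_linear.linear [OF linear_A])
qed

text \<open>Pulling the unstable series back by one step exhibits it as the image under \<open>inv (A n)\<close> of a
  convergent series in the closed subspace \<open>U (n + 1)\<close>.\<close>

lemma green_in_Z: "green g n \<in> Z n"
proof -
  have "(\<Sum>j. stable_term g n j) \<in> S n"
    by (intro closed_subspace_suminf subspace_S closed_S summable_stable_term)
      (simp add: stable_term_def cocycle_S proj_along_decomp [OF splitting])
  moreover have "A n (\<Sum>j. unstable_term g n j) \<in> U (n + 1)"
    unfolding bounded_linear.suminf [OF linear_A summable_unstable_term]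
    by (intro closed_subspace_suminf subspace_U closed_U
        bounded_linear.summable [OF linear_A summable_unstable_term])
      (simp add: unstable_term_def cocycle_U proj_along_decomp [OF splitting] flip: cocycle_A_step)
  then have "- (A n (\<Sum>j. unstable_term g n j)) \<in> U (n + 1)"
    using subspace_U subspace_neg by blast
  then have "inv (A n) (- (A n (\<Sum>j. unstable_term g n j))) \<in> inv (A n) ` U (n + 1)"
    by (rule imageI)
  then have "- (\<Sum>j. unstable_term g n j) \<in> inv (A n) ` U (n + 1)"
    by (simp add: linear_neg bounded_linear.linear [OF linear_inv_A])
  ultimately show ?thesis
    unfolding green_def Z_def diff_conv_add_uminus by (rule set_plus_intro)
qed

end

section \<open>Bounded solutions of forced and nonlinear equations\<close>

definition bsol :: "(int \<Rightarrow> 'a) \<Rightarrow> (int \<Rightarrow> 'a) \<Rightarrow> bool" where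
  "bsol g y \<longleftrightarrow> (\<forall>n. y (n + 1) = A n (y n) + g n) \<and> bounded (range y) \<and> (\<forall>n. y n \<in> Z n)"

lemma bsol_diff:
  assumes "bsol g y" "bsol g' y'"
  shows "bsol (\<lambda>n. g n - g' n) (\<lambda>n. y n - y' n)"
proof -
  have "bounded (range (\<lambda>n. y n - y' n))"
    using assms by (intro bounded_minus_comp) (auto simp: bsol_def)
  with assms show ?thesis
    by (auto simp: bsol_def linear_diff bounded_linear.linear [OF linear_A]
        intro: subspace_diff [OF subspace_Z])
qed

lemma vanishes_of_exp_decay:
  fixes x :: 'a
  assumes "\<And>j. norm x \<le> R * exp (- lam * real j)"
  shows "x = 0"
proof -
  have "(\<lambda>j. R * exp (- lam) ^ j) \<longlonglongrightarrow> R * 0"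
    using lam_pos by (intro tendsto_mult tendsto_const LIMSEQ_realpow_zero) auto
  moreover have "norm x \<le> R * exp (- lam) ^ j" for j
    using assms [of j] by (simp add: mult.commute flip: exp_of_nat_mult)
  ultimately have "norm x \<le> R * 0" by (intro LIMSEQ_le_const) auto
  then show ?thesis by simp
qed

text \<open>Because of the condition \<open>y n \<in> Z n\<close>, the stable and unstable components of a solution of
  the homogeneous equation are themselves orbits.  Tracing the first back from the distant past and
  the second from the distant future, exponential contraction of bounded data forces both to be
  zero.\<close>

lemma bsol_zero:
  assumes y: "bsol (\<lambda>_. 0) y"
  shows "y n = 0"
proof -
  from y obtain B where B: "\<And>k. norm (y k) \<le> B" by (auto simp: bsol_def bounded_iff)
  define s where "s k = P k (y k)" for k
  define u where "u k = y k - P k (y k)" for k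
  have s_S: "s k \<in> S k" and u_U: "u k \<in> U k" for k
    unfolding s_def u_def by (simp_all add: proj_along_decomp [OF splitting])
  have s_step: "s (k + 1) = A k (s k)" for k
  proof -
    from y have "y k \<in> Z k" by (simp add: bsol_def)
    then obtain a b where ab: "a \<in> S k" "b \<in> U (k + 1)" "y k = a + inv (A k) b"
      by (auto simp: Z_def elim!: set_plus_elim)
    then have "s k = a"
      unfolding s_def ab(3) using A_U by (intro proj_along_unique [OF splitting]) auto
    have "y (k + 1) = A k a + b"
      using y by (simp add: bsol_def ab(3) linear_add bounded_linear.linear [OF linear_A])
    then have "s (k + 1) = A k a"
      unfolding s_def using ab A_S by (auto intro: proj_along_unique [OF splitting])
    with \<open>s k = a\<close> show ?thesis by simp
  qed
  have u_step: "u (k + 1) = A k (u k)" for k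
    using y s_step [of k]
    by (simp add: bsol_def u_def s_def linear_diff bounded_linear.linear [OF linear_A])
  have "s n = 0"
  proof (rule vanishes_of_exp_decay)
    fix j :: nat
    have "s n = cocycle A n (n - int j) (s (n - int j))"
      using s_step by (rule orbit_eq_cocycle [OF bij_A])
    then have "norm (s n) \<le> D * exp (- lam * j) * norm (s (n - int j))"
      using stable [OF s_S, of "n - int j" n] by simp
    also have "\<dots> \<le> D * exp (- lam * j) * (K * B)"
      unfolding s_def using D_pos K_nonneg B
      by (intro mult_left_mono order_trans [OF proj_bound]) auto
    finally show "norm (s n) \<le> (D * K * B) * exp (- lam * j)" by (simp add: algebra_simps)
  qed
  moreover have "u n = 0"
  proof (rule vanishes_of_exp_decay)
    fix j :: nat
    have "u n = cocycle A n (n + int j) (u (n + int j))"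
      using u_step by (rule orbit_eq_cocycle [OF bij_A])
    then have "norm (u n) \<le> D * exp (- lam * j) * norm (u (n + int j))"
      using unstable [OF u_U, of n "n + int j"] by simp
    also have "\<dots> \<le> D * exp (- lam * j) * (B + K * B)"
    proof (rule mult_left_mono)
      have "K * norm (y (n + int j)) \<le> K * B" using K_nonneg B by (intro mult_left_mono)
      then show "norm (u (n + int j)) \<le> B + K * B"
        unfolding u_def
        by (intro order_trans [OF norm_triangle_ineq4] add_mono B order_trans [OF proj_bound])
    qed (use D_pos in simp)
    finally show "norm (u n) \<le> (D * (B + K * B)) * exp (- lam * j)" by (simp add: algebra_simps)
  qed
  ultimately show ?thesis by (simp add: s_def u_def)
qed

lemma bsol_unique:
  assumes "bsol g y" "bsol g y'"
  shows "y = y'"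
proof
  fix n
  have "bsol (\<lambda>_. 0) (\<lambda>n. y n - y' n)" using bsol_diff [OF assms] by simp
  from bsol_zero [OF this] have "y n - y' n = 0" .
  then show "y n = y' n" by simp
qed

lemma green_bsol:
  assumes "bounded (range g)"
  shows "bsol g (green g)"
proof -
  from assms obtain M where "\<And>k. norm (g k) \<le> M" by (auto simp: bounded_iff)
  then have g: "\<And>k. norm (g k) \<le> M * exp (0 * real_of_int \<bar>k - 0\<bar>)" by simp
  have "norm (green g n) \<le> kappa 0 * M" for n
    using green_bound [OF g _ lam_pos] by simp
  then have "bounded (range (green g))" by (auto simp: bounded_iff)
  then show ?thesis
    unfolding bsol_def using green_step [OF g _ lam_pos] green_in_Z [OF g _ lam_pos] by simp
qed

lemma bsol_bound:
  assumes "bsol g y" "bounded (range g)"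
    and "\<And>k. norm (g k) \<le> N * exp (\<mu> * real_of_int \<bar>k - n0\<bar>)" "0 \<le> \<mu>" "\<mu> < lam"
  shows "norm (y n) \<le> kappa \<mu> * N * exp (\<mu> * real_of_int \<bar>n - n0\<bar>)"
  using green_bound [OF assms(3-5)] bsol_unique [OF assms(1) green_bsol [OF assms(2)]] by simp

lemma bsol_sup_bound:
  assumes "bsol g y" and N: "\<And>k. norm (g k) \<le> N"
  shows "norm (y n) \<le> kappa 0 * N"
  using bsol_bound [OF assms(1), of N 0 0 n] N lam_pos by (auto simp: bounded_iff)

text \<open>Freezing the argument of the nonlinearity and applying the Green operator gives a
  self-map of the space of bounded sequences whose Lipschitz constant is \<open>c * kappa 0\<close>.  Since the
  integers are discrete, bounded sequences are exactly the bounded continuous functions on them.\<close>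

lemma nonlinear_bsol:
  assumes Lip: "\<And>n z z'. norm (\<phi> n z - \<phi> n z') \<le> c * norm (z - z')"
    and M: "\<And>n z. norm (\<phi> n z) \<le> M" and c: "0 \<le> c" "c * kappa 0 < 1"
  shows "\<exists>!y. bsol (\<lambda>n. \<phi> n (y n)) y"
proof -
  define T where "T y = Bcontfun (green (\<lambda>n. \<phi> n (apply_bcontfun y n)))" for y :: "int \<Rightarrow>\<^sub>C 'a"
  have bdd: "bounded (range (\<lambda>n. \<phi> n (y n)))" for y
    using M by (auto simp: bounded_iff)
  have T: "apply_bcontfun (T y) = green (\<lambda>n. \<phi> n (apply_bcontfun y n))" for y
    unfolding T_def using green_bsol [OF bdd, of "apply_bcontfun y"]
    by (intro Bcontfun_inverse) (simp add: bcontfun_def bsol_def)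
  have "dist (T y) (T y') \<le> (c * kappa 0) * dist y y'" for y y'
  proof (rule dist_bound)
    fix n
    have "norm (\<phi> n (apply_bcontfun y n) - \<phi> n (apply_bcontfun y' n)) \<le> c * dist y y'" for n
      using c(1) by (intro order_trans [OF Lip] mult_left_mono)
        (simp_all add: dist_bounded flip: dist_norm)
    from bsol_sup_bound [OF bsol_diff [OF green_bsol green_bsol] this, OF bdd bdd]
    show "dist (T y n) (T y' n) \<le> (c * kappa 0) * dist y y'"
      unfolding T dist_norm by (simp add: algebra_simps)
  qed
  then have "\<exists>!y. T y = y"
    using Banach_fix [OF complete_bcontfun, of "c * kappa 0" T] c kappa_pos [OF lam_pos] by simp
  then obtain y where y: "T y = y" and uniq: "\<And>y'. T y' = y' \<Longrightarrow> y' = y" by blast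
  show ?thesis
  proof (rule ex1I)
    show "bsol (\<lambda>n. \<phi> n (apply_bcontfun y n)) (apply_bcontfun y)"
      using green_bsol [OF bdd, of "apply_bcontfun y"] unfolding T [symmetric] y .
  next
    fix v assume v: "bsol (\<lambda>n. \<phi> n (v n)) v"
    then have "v \<in> bcontfun" by (simp add: bcontfun_def bsol_def)
    then obtain y' where y': "v = apply_bcontfun y'" by (rule bcontfunE)
    have "apply_bcontfun (T y') = apply_bcontfun y'"
      unfolding T using bsol_unique [OF green_bsol [OF bdd] v] y' by simp
    then have "T y' = y'" by (simp add: apply_bcontfun_inject)
    then show "v = apply_bcontfun y" using uniq y' by simp
  qed
qed

section \<open>Shadowing maps between perturbations\<close>

definition perturbed :: "(int \<Rightarrow> 'a \<Rightarrow> 'a) \<Rightarrow> int \<Rightarrow> 'a \<Rightarrow> 'a" where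
  "perturbed f n x = A n x + f n x"

text \<open>Both sides are perturbations of the linear cocycle, rather than one side being the cocycle
  itself.  This makes the notion closed under composition and symmetric in form, so that a single
  existence, uniqueness and regularity theorem serves for the conjugacy and for its inverse.\<close>

definition semiconj :: "(int \<Rightarrow> 'a \<Rightarrow> 'a) \<Rightarrow> (int \<Rightarrow> 'a \<Rightarrow> 'a) \<Rightarrow> (int \<Rightarrow> 'a \<Rightarrow> 'a) \<Rightarrow> bool" where
  "semiconj f g H \<longleftrightarrow>
    (\<forall>n x. H (n + 1) (perturbed f n x) = perturbed g n (H n x)) \<and>
    (\<exists>M. \<forall>n x. norm (H n x - x) \<le> M) \<and> (\<forall>n x. H n x - x \<in> Z n)"

lemma semiconj_id: "semiconj f f (\<lambda>n x. x)"
  using subspace_0 [OF subspace_Z] by (auto simp: semiconj_def)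

lemma semiconj_comp:
  assumes "semiconj f g H" "semiconj g h H'"
  shows "semiconj f h (\<lambda>n x. H' n (H n x))"
proof -
  from assms obtain M M' where M: "\<And>n x. norm (H n x - x) \<le> M" "\<And>n x. norm (H' n x - x) \<le> M'"
    by (auto simp: semiconj_def)
  have e: "H' n (H n x) - x = (H' n (H n x) - H n x) + (H n x - x)" for n x by simp
  have "norm (H' n (H n x) - x) \<le> M' + M" for n x
    unfolding e [of n x] by (intro norm_triangle_le add_mono M)
  moreover have "H' n (H n x) - x \<in> Z n" for n x
    unfolding e [of n x] using assms by (intro subspace_add [OF subspace_Z]) (auto simp: semiconj_def)
  ultimately show ?thesis using assms by (auto simp: semiconj_def)
qed

text \<open>Along an orbit \<open>w\<close> of the first system, the displacement of the image orbit solves a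
  forced linear equation.\<close>

lemma semiconj_bsol:
  assumes H: "semiconj f g H" and w: "\<And>n. w (n + 1) = perturbed f n (w n)"
  shows "bsol (\<lambda>n. g n (H n (w n)) - f n (w n)) (\<lambda>n. H n (w n) - w n)"
proof -
  have "H (n + 1) (w (n + 1)) - w (n + 1) = A n (H n (w n) - w n) + (g n (H n (w n)) - f n (w n))" for n
    using H w by (simp add: semiconj_def linear_diff bounded_linear.linear [OF linear_A])
      (simp add: perturbed_def)
  moreover from H obtain M where "\<And>n x. norm (H n x - x) \<le> M" by (auto simp: semiconj_def)
  then have "bounded (range (\<lambda>n. H n (w n) - w n))" by (auto simp: bounded_iff)
  ultimately show ?thesis using H by (auto simp: bsol_def semiconj_def)
qed

text \<open>For every orbit \<open>w\<close> of the first system there is exactly one orbit \<open>w + q\<close> of the second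
  with bounded displacement in \<open>Z\<close>, by the fixed point lemma for the nonlinearity
  \<open>z \<mapsto> g n (w n + z) - f n (w n)\<close>.  The value at \<open>(n, x)\<close> is read off from the orbit through that
  point; equivariance holds because neighbouring points of an orbit define the same orbit.\<close>

lemma semiconj_ex1:
  assumes bij_F: "\<And>n. bij (perturbed f n)"
    and f: "\<And>n x. norm (f n x) \<le> M" and g: "\<And>n x. norm (g n x) \<le> M"
    and Lip: "\<And>n x y. norm (g n x - g n y) \<le> c * norm (x - y)"
    and c: "0 \<le> c" "c * kappa 0 < 1"
  shows "\<exists>!H. semiconj f g H"
proof -
  let ?orb = "\<lambda>n x k. cocycle (perturbed f) k n x"
  have bound: "norm (g n a - f n b) \<le> 2 * M" for n a b
    using norm_triangle_ineq4 [of "g n a" "f n b"] f [of n b] g [of n a] by linarith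
  have Lip': "norm (g n (a + z) - b - (g n (a + z') - b)) \<le> c * norm (z - z')" for n a b z z'
    using Lip [of n "a + z" "a + z'"] by simp
  have ex1: "\<exists>!q. bsol (\<lambda>n. g n (w n + q n) - f n (w n)) q" for w
    using nonlinear_bsol [of "\<lambda>n z. g n (w n + z) - f n (w n)", OF Lip' bound c] .
  define q where "q w = (THE q. bsol (\<lambda>n. g n (w n + q n) - f n (w n)) q)" for w
  have q: "bsol (\<lambda>n. g n (w n + q w n) - f n (w n)) (q w)" for w
    unfolding q_def by (rule theI' [OF ex1])
  define H where "H n x = x + q (?orb n x) n" for n x
  have "semiconj f g H"
    unfolding semiconj_def
  proof (intro conjI allI exI)
    fix n x
    let ?w = "?orb n x"
    have w: "?w (n + 1) = perturbed f n x"
      using cocycle_step [of "perturbed f" n n x] bij_F by simp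
    have "?orb (n + 1) (?w (n + 1)) = ?w"
      using cocycle_comp [of "perturbed f"] bij_F by (simp add: fun_eq_iff)
    then have "H (n + 1) (perturbed f n x) = perturbed f n x + q ?w (n + 1)"
      by (simp add: H_def w)
    also have "\<dots> = perturbed g n (H n x)"
      using q [of ?w] by (simp add: bsol_def perturbed_def H_def linear_add bounded_linear.linear [OF linear_A])
    finally show "H (n + 1) (perturbed f n x) = perturbed g n (H n x)" .
    show "norm (H n x - x) \<le> kappa 0 * (2 * M)"
      using bsol_sup_bound [OF q [of ?w] bound] by (simp add: H_def)
    show "H n x - x \<in> Z n" using q [of ?w] by (simp add: bsol_def H_def)
  qed
  moreover have "H = H'" if H': "semiconj f g H'" for H'
  proof (intro ext)
    fix n x
    have "H n x - x = q (?orb n x) n" by (simp add: H_def)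
    moreover have "bsol (\<lambda>k. g k (?orb n x k + (H' k (?orb n x k) - ?orb n x k)) - f k (?orb n x k))
        (\<lambda>k. H' k (?orb n x k) - ?orb n x k)"
      using semiconj_bsol [OF H', of "?orb n x"] cocycle_step [of "perturbed f", OF bij_F] by simp
    then have "q (?orb n x) = (\<lambda>k. H' k (?orb n x k) - ?orb n x k)"
      unfolding q_def by (rule the1_equality [OF ex1])
    from fun_cong [OF this, of n] have "H' n x - x = q (?orb n x) n" by simp
    ultimately have "H n x - x = H' n x - x" by (rule trans [OF _ sym])
    then show "H n x = H' n x" by simp
  qed
  ultimately show ?thesis by blast
qed

text \<open>The composition and the identity are both shadowing maps from a system to itself, and there
  is only one such map.\<close>

lemma semiconj_inverse:
  assumes "semiconj f g H" "semiconj g f H'" and uniq: "\<exists>!J. semiconj f f J"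
  shows "H' n (H n x) = x"
  using semiconj_comp [OF assms(1,2)] semiconj_id uniq by metis

end

section \<open>Growth and regularity estimates\<close>

text \<open>The sum includes the term \<open>i = k\<close>, as it must for backward iteration of a nonlinear system,
  where the perturbation is evaluated at the unknown point.  Solving for this term costs the factor
  \<open>1 / (1 - p) \<le> exp \<theta>\<close> in each step.\<close>

lemma weighted_gronwall:
  fixes v :: "nat \<Rightarrow> real"
  assumes v: "\<And>k. v k \<le> a * exp (\<sigma> * k) + p * (\<Sum>i\<le>k. exp (\<sigma> * (real k - real i)) * v i)"
    and a: "0 \<le> a" and p: "0 \<le> p" "p \<le> 1 - exp (- \<theta>)" and v0: "\<And>k. 0 \<le> v k"
  shows "v k \<le> a * exp \<theta> * exp ((\<sigma> + \<theta>) * k)"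
proof -
  define b where "b k = exp (- (\<sigma> * k)) * v k" for k
  have b0: "0 \<le> b k" for k by (simp add: b_def v0)
  define B where "B k = a + p * (\<Sum>i\<le>k. b i)" for k
  have b_le_B: "b k \<le> B k" for k
  proof -
    have "b k \<le> exp (- (\<sigma> * k)) * (a * exp (\<sigma> * k) + p * (\<Sum>i\<le>k. exp (\<sigma> * (real k - real i)) * v i))"
      unfolding b_def by (intro mult_left_mono v) simp
    also have "\<dots> = B k"
      unfolding B_def b_def
      by (simp add: algebra_simps sum_distrib_left flip: exp_add)
    finally show ?thesis .
  qed
  \<comment> \<open>The implicit term is moved to the left, using \<open>exp (- \<theta>) \<le> 1 - p\<close>.\<close>
  have absorb: "y \<le> x * exp \<theta>" if "y \<le> x + p * y" "0 \<le> y" for x y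
  proof -
    have "exp (- \<theta>) * y \<le> (1 - p) * y" using p that(2) by (intro mult_right_mono) auto
    also have "\<dots> \<le> x" using that(1) by (simp add: algebra_simps)
    finally show ?thesis by (simp add: exp_minus field_simps)
  qed
  have B0: "0 \<le> B k" for k unfolding B_def using a p b0 by (simp add: sum_nonneg)
  have "B k \<le> a * exp (\<theta> * Suc k)"
  proof (induction k)
    case 0
    have "B 0 \<le> a + p * B 0" using mult_left_mono [OF b_le_B p(1), of 0] by (simp add: B_def)
    from absorb [OF this B0] show ?case by simp
  next
    case (Suc k)
    have "B (Suc k) \<le> B k + p * B (Suc k)"
      using mult_left_mono [OF b_le_B p(1), of "Suc k"] by (simp add: B_def algebra_simps)
    from absorb [OF this B0] have "B (Suc k) \<le> B k * exp \<theta>" .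
    also have "\<dots> \<le> a * exp (\<theta> * Suc k) * exp \<theta>" using Suc by (intro mult_right_mono) auto
    finally show ?case by (simp add: algebra_simps flip: exp_add)
  qed
  with b_le_B have "b k \<le> a * exp (\<theta> * Suc k)" by (rule order_trans)
  then have "exp (\<sigma> * k) * b k \<le> exp (\<sigma> * k) * (a * exp (\<theta> * Suc k))"
    by (intro mult_left_mono) auto
  then show ?thesis by (simp add: b_def algebra_simps flip: exp_add)
qed

text \<open>Interpolation between a Lipschitz bound (for small \<open>t\<close>) and a uniform bound (for large
  \<open>t\<close>).\<close>

lemma le_powr_of_bounds:
  fixes s t R \<alpha> :: real
  assumes "s \<le> t" "s \<le> R" "0 \<le> t" "1 \<le> R" "0 < \<alpha>" "\<alpha> \<le> 1"
  shows "s \<le> R * t powr \<alpha>"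
proof (cases "t \<le> 1")
  case True
  have "s \<le> t powr 1" using assms by simp
  also have "\<dots> \<le> t powr \<alpha>"
    using True assms by (intro powr_mono') auto
  also have "\<dots> \<le> R * t powr \<alpha>" using assms by (simp add: mult_le_cancel_right1)
  finally show ?thesis .
next
  case False
  then have "1 \<le> t powr \<alpha>" using assms by (intro ge_one_powr_ge_zero) auto
  then have "R * 1 \<le> R * t powr \<alpha>" using assms by (intro mult_left_mono) auto
  then show ?thesis using assms(2) by linarith
qed

text \<open>The displacement \<open>h - id\<close> is globally Hoelder, whereas the identity is \<open>\<alpha>\<close>-Hoelder only at
  bounded distances; this is the sole reason for restricting to bounded sets.\<close>

lemma holder_on_bounded:
  fixes h :: "'b::real_normed_vector \<Rightarrow> 'b"
  assumes E: "\<And>x y. norm ((h x - x) - (h y - y)) \<le> E * norm (x - y) powr \<alpha>"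
    and \<alpha>: "0 < \<alpha>" "\<alpha> \<le> 1" and "bounded B"
  shows "holder_on \<alpha> B h"
proof -
  from \<open>bounded B\<close> obtain R where R: "\<And>x. x \<in> B \<Longrightarrow> norm x \<le> R" by (auto simp: bounded_iff)
  let ?R = "2 * max 1 R"
  have "norm (h x - h y) \<le> (?R + \<bar>E\<bar>) * norm (x - y) powr \<alpha>" if "x \<in> B" "y \<in> B" for x y
  proof -
    have "norm (x - y) \<le> ?R"
      using norm_triangle_ineq4 [of x y] R [OF that(1)] R [OF that(2)] by simp
    then have "norm (x - y) \<le> ?R * norm (x - y) powr \<alpha>"
      using \<alpha> by (intro le_powr_of_bounds) auto
    moreover have "E * norm (x - y) powr \<alpha> \<le> \<bar>E\<bar> * norm (x - y) powr \<alpha>"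
      by (intro mult_right_mono) auto
    moreover have "norm (h x - h y) \<le> norm (x - y) + norm ((h x - x) - (h y - y))"
      using norm_triangle_ineq [of "x - y" "(h x - x) - (h y - y)"] by simp
    ultimately show ?thesis using E [of x y] by (simp add: algebra_simps)
  qed
  then show ?thesis unfolding holder_on_def by (intro exI [of _ "?R + \<bar>E\<bar>"]) auto
qed

lemma continuous_on_of_holder:
  assumes h: "\<And>B. bounded B \<Longrightarrow> holder_on \<alpha> B h" and "0 < \<alpha>"
  shows "continuous_on UNIV h"
  unfolding continuous_on_eq_continuous_at [OF open_UNIV]
proof
  fix x
  obtain L where "\<forall>y\<in>ball x 1. \<forall>z\<in>ball x 1. norm (h y - h z) \<le> L * norm (y - z) powr \<alpha>"
    using h [OF bounded_ball [of x 1]] unfolding holder_on_def by blast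
  then have L: "\<And>y. y \<in> ball x 1 \<Longrightarrow> norm (h y - h x) \<le> L * norm (y - x) powr \<alpha>"
    by simp
  have "((\<lambda>y. L * norm (y - x) powr \<alpha>) \<longlongrightarrow> L * norm (x - x) powr \<alpha>) (at x)"
    using \<open>0 < \<alpha>\<close> by (intro tendsto_intros tendsto_powr') auto
  then have "((\<lambda>y. L * norm (y - x) powr \<alpha>) \<longlongrightarrow> 0) (at x)" by simp
  moreover have "\<forall>\<^sub>F y in at x. norm (h y - h x) \<le> L * norm (y - x) powr \<alpha>"
    using eventually_at_ball [of 1 x UNIV] by (auto elim!: eventually_mono intro: L)
  ultimately have "((\<lambda>y. h y - h x) \<longlongrightarrow> 0) (at x)"
    by (rule Lim_null_comparison [rotated])
  then show "isCont h x" by (simp add: isCont_def LIM_zero_iff)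
qed

text \<open>\<open>W n\<close> absorbs the subexponential part of the nonuniform growth bound, at the cost of
  enlarging the exponential rate to \<open>\<sigma>\<close>.\<close>

locale weighted_dichotomy = dichotomy +
  fixes W :: "int \<Rightarrow> real" and \<sigma> :: real
  assumes W_ge_1: "1 \<le> W n" and sigma_nonneg: "0 \<le> \<sigma>"
    and growth: "norm (cocycle A m n x) \<le> W n * exp (\<sigma> * real_of_int \<bar>m - n\<bar>) * norm x"
begin

context
  fixes v r :: "int \<Rightarrow> 'a" and c \<theta> :: real
  assumes v: "\<And>k. v (k + 1) = A k (v k) + r k"
    and r: "\<And>k. norm (r k) \<le> inverse (W (k + 1)) * c * norm (v k)"
    and c: "0 \<le> c" "c * exp \<sigma> \<le> 1 - exp (- \<theta>)"
begin

text \<open>The smallness \<open>inverse (W (k + 1)) * c\<close> of the perturbation is designed for this estimate: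
  it cancels the nonuniform constant paid for transporting the remainder from time \<open>k + 1\<close>, and
  leaves a bound uniform in \<open>k\<close>.\<close>

lemma propagated_remainder_bound:
  "norm (cocycle A m (k + 1) (r k)) \<le> exp (\<sigma> * real_of_int \<bar>m - (k + 1)\<bar>) * (c * norm (v k))"
proof -
  have "norm (cocycle A m (k + 1) (r k)) \<le>
      W (k + 1) * exp (\<sigma> * real_of_int \<bar>m - (k + 1)\<bar>) * (inverse (W (k + 1)) * c * norm (v k))"
    using W_ge_1 [of "k + 1"] by (intro order_trans [OF growth] mult_left_mono r) auto
  also have "\<dots> = exp (\<sigma> * real_of_int \<bar>m - (k + 1)\<bar>) * (c * norm (v k))"
    using W_ge_1 [of "k + 1"] by simp
  finally show ?thesis .
qed

lemma variation_of_constants_forward: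
  "v (n + int k) = cocycle A (n + int k) n (v n)
    + (\<Sum>i<k. cocycle A (n + int k) (n + int i + 1) (r (n + int i)))"
proof (induction k)
  case (Suc k)
  have e: "n + int (Suc k) = (n + int k) + 1" by simp
  show ?case
    unfolding e cocycle_A_step v Suc
    by (simp add: linear_add linear_sum bounded_linear.linear [OF linear_A])
      (simp add: cocycle_self flip: cocycle_A_step)
qed simp

lemma variation_of_constants_backward:
  "v (n - int k) = cocycle A (n - int k) n (v n)
    - (\<Sum>i<k. cocycle A (n - int k) (n - int (Suc i) + 1) (r (n - int (Suc i))))"
proof (induction k)
  case (Suc k)
  let ?m = "n - int (Suc k)"
  have e: "n - int k = ?m + 1" by simp
  have "A ?m (v ?m) = v (?m + 1) - r ?m" using v [of ?m] by simp
  also have "\<dots> = A ?m (cocycle A ?m n (v n)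
      - (\<Sum>i<Suc k. cocycle A ?m (n - int (Suc i) + 1) (r (n - int (Suc i)))))"
    using Suc unfolding e cocycle_A_step
    by (simp add: linear_diff linear_add linear_sum bounded_linear.linear [OF linear_A])
      (simp add: cocycle_self flip: cocycle_A_step)
  finally have "inv (A ?m) (A ?m (v ?m)) = inv (A ?m) (A ?m (cocycle A ?m n (v n)
      - (\<Sum>i<Suc k. cocycle A ?m (n - int (Suc i) + 1) (r (n - int (Suc i))))))" by simp
  then show ?case unfolding inv_A_A .
qed simp

lemma forward_growth:
  "norm (v (n + int k)) \<le> (W n * norm (v n)) * exp \<theta> * exp ((\<sigma> + \<theta>) * k)"
proof (rule weighted_gronwall [where p = "c * exp \<sigma>"])
  fix k
  have "norm (v (n + int k)) \<le> norm (cocycle A (n + int k) n (v n))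
      + (\<Sum>i<k. norm (cocycle A (n + int k) (n + int i + 1) (r (n + int i))))"
    unfolding variation_of_constants_forward [of n k]
    by (intro order_trans [OF norm_triangle_ineq] add_left_mono norm_sum)
  also have "\<dots> \<le> W n * exp (\<sigma> * k) * norm (v n)
      + (\<Sum>i<k. (c * exp \<sigma>) * (exp (\<sigma> * (real k - real i)) * norm (v (n + int i))))"
  proof (intro add_mono sum_mono)
    show "norm (cocycle A (n + int k) n (v n)) \<le> W n * exp (\<sigma> * k) * norm (v n)"
      using growth [of "n + int k" n "v n"] by simp
    fix i assume "i \<in> {..<k}"
    then have "real_of_int \<bar>n + int k - (n + int i + 1)\<bar> \<le> (real k - real i) + 1" by simp
    then have "exp (\<sigma> * real_of_int \<bar>n + int k - (n + int i + 1)\<bar>) \<le> exp (\<sigma> * (real k - real i + 1))"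
      using sigma_nonneg by (simp only: exp_le_cancel_iff mult_left_mono)
    also have "\<dots> = exp \<sigma> * exp (\<sigma> * (real k - real i))"
      by (simp add: algebra_simps flip: exp_add)
    finally have "exp (\<sigma> * real_of_int \<bar>n + int k - (n + int i + 1)\<bar>) * (c * norm (v (n + int i)))
        \<le> exp \<sigma> * exp (\<sigma> * (real k - real i)) * (c * norm (v (n + int i)))"
      using c by (intro mult_right_mono) auto
    with propagated_remainder_bound [of "n + int k" "n + int i"]
    show "norm (cocycle A (n + int k) (n + int i + 1) (r (n + int i)))
        \<le> (c * exp \<sigma>) * (exp (\<sigma> * (real k - real i)) * norm (v (n + int i)))"
      by (simp add: algebra_simps)
  qed
  also have "\<dots> \<le> W n * exp (\<sigma> * k) * norm (v n)
      + (\<Sum>i\<le>k. (c * exp \<sigma>) * (exp (\<sigma> * (real k - real i)) * norm (v (n + int i))))"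
    using c by (intro add_left_mono sum_mono2) auto
  finally show "norm (v (n + int k)) \<le> (W n * norm (v n)) * exp (\<sigma> * k)
      + (c * exp \<sigma>) * (\<Sum>i\<le>k. exp (\<sigma> * (real k - real i)) * norm (v (n + int i)))"
    by (simp add: sum_distrib_left algebra_simps)
qed (use c W_ge_1 [of n] in auto)

lemma backward_growth:
  "norm (v (n - int k)) \<le> (W n * norm (v n)) * exp \<theta> * exp ((\<sigma> + \<theta>) * k)"
proof (rule weighted_gronwall [where p = "c * exp \<sigma>"])
  fix k
  let ?s = "\<lambda>i. (c * exp \<sigma>) * (exp (\<sigma> * (real k - real i)) * norm (v (n - int i)))"
  have "norm (v (n - int k)) \<le> norm (cocycle A (n - int k) n (v n))
      + (\<Sum>i<k. norm (cocycle A (n - int k) (n - int (Suc i) + 1) (r (n - int (Suc i)))))"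
    unfolding variation_of_constants_backward [of n k]
    by (intro order_trans [OF norm_triangle_ineq4] add_left_mono norm_sum)
  also have "\<dots> \<le> W n * exp (\<sigma> * k) * norm (v n) + (\<Sum>i<k. ?s (Suc i))"
  proof (intro add_mono sum_mono)
    show "norm (cocycle A (n - int k) n (v n)) \<le> W n * exp (\<sigma> * k) * norm (v n)"
      using growth [of "n - int k" n "v n"] by simp
    fix i assume i: "i \<in> {..<k}"
    have "real_of_int \<bar>n - int k - (n - int (Suc i) + 1)\<bar> = real k - real i" using i by simp
    then have "exp (\<sigma> * real_of_int \<bar>n - int k - (n - int (Suc i) + 1)\<bar>)
        = exp \<sigma> * exp (\<sigma> * (real k - real (Suc i)))"
      by (simp add: algebra_simps flip: exp_add)
    with propagated_remainder_bound [of "n - int k" "n - int (Suc i)"]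
    show "norm (cocycle A (n - int k) (n - int (Suc i) + 1) (r (n - int (Suc i)))) \<le> ?s (Suc i)"
      by (simp only: mult_ac)
  qed
  also have "\<dots> \<le> W n * exp (\<sigma> * k) * norm (v n) + (\<Sum>i\<le>k. ?s i)"
    unfolding sum.atMost_shift using c by simp
  finally show "norm (v (n - int k)) \<le> (W n * norm (v n)) * exp (\<sigma> * k)
      + (c * exp \<sigma>) * (\<Sum>i\<le>k. exp (\<sigma> * (real k - real i)) * norm (v (n - int i)))"
    by (simp add: sum_distrib_left algebra_simps)
qed (use c W_ge_1 [of n] in auto)

text \<open>Orbits of a perturbed system separate at a rate \<open>\<sigma> + \<theta>\<close> only slightly above that of the
  linear cocycle, with the same nonuniform constant \<open>W n\<close> at the base time.  The sequence \<open>v\<close> is to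
  be thought of as the difference of two such orbits.\<close>

lemma perturbed_growth:
  "norm (v m) \<le> W n * exp \<theta> * norm (v n) * exp ((\<sigma> + \<theta>) * real_of_int \<bar>m - n\<bar>)"
proof (cases "n \<le> m")
  case True
  then show ?thesis using forward_growth [of n "nat (m - n)"] by (simp add: mult_ac)
next
  case False
  then show ?thesis using backward_growth [of n "nat (n - m)"] by (simp add: mult_ac)
qed

end

text \<open>For two orbits \<open>w\<close>, \<open>w'\<close> let \<open>d k\<close> be the difference of their displacements; it is the
  bounded solution of an equation with forcing \<open>h\<close>.  The part of \<open>h\<close> caused by \<open>w k - w' k\<close> is both
  bounded and Lipschitz, hence at most a multiple of \<open>norm (w k - w' k) powr \<alpha>\<close>, which grows with
  rate \<open>\<mu> = \<alpha> * (\<sigma> + \<theta>)\<close> below \<open>lam\<close>; the part caused by \<open>d k\<close> is small.  The weighted supremum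
  of \<open>d\<close> therefore bounds itself up to a factor \<open>1 / 2\<close>, and at time \<open>n\<close> the weight is 1.\<close>

lemma semiconj_displacement_holder:
  assumes H: "semiconj f g H" and bij_F: "\<And>n. bij (perturbed f n)"
    and fM: "\<And>n x. norm (f n x) \<le> M" and gM: "\<And>n x. norm (g n x) \<le> M" and M: "1 \<le> M"
    and f_Lip: "\<And>n x y. norm (f n x - f n y) \<le> inverse (W (n + 1)) * c * norm (x - y)"
    and g_Lip: "\<And>n x y. norm (g n x - g n y) \<le> inverse (W (n + 1)) * c * norm (x - y)"
    and c: "0 \<le> c" "c \<le> 1" "c * exp \<sigma> \<le> 1 - exp (- \<theta>)"
    and \<alpha>: "0 < \<alpha>" "\<alpha> \<le> 1" and mu: "\<mu> = \<alpha> * (\<sigma> + \<theta>)" "0 \<le> \<mu>" "\<mu> < lam"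
    and small: "c * kappa \<mu> \<le> 1 / 2"
  shows "norm ((H n x - x) - (H n y - y)) \<le>
    8 * M * kappa \<mu> * (W n * exp \<theta>) powr \<alpha> * norm (x - y) powr \<alpha>"
proof -
  define w where "w k = cocycle (perturbed f) k n x" for k
  define w' where "w' k = cocycle (perturbed f) k n y" for k
  have w: "w (k + 1) = perturbed f k (w k)" and w': "w' (k + 1) = perturbed f k (w' k)" for k
    unfolding w_def w'_def by (simp_all add: cocycle_step [OF bij_F])
  have weak: "inverse (W (k + 1)) * c * norm u \<le> c * norm (u :: 'a)" for k u
  proof -
    have "inverse (W (k + 1)) \<le> 1" using W_ge_1 by (simp add: inverse_le_1_iff)
    then show ?thesis using c(1) mult_right_mono [of "inverse (W (k + 1))" 1 "c * norm u"] by simp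
  qed
  define \<delta> where "\<delta> = norm (x - y)"
  define E where "E = 4 * M * ((W n * exp \<theta>) powr \<alpha> * \<delta> powr \<alpha>)"
  define e where "e k = exp (\<mu> * real_of_int \<bar>k - n\<bar>)" for k
  have e_pos: "0 < e k" for k by (simp add: e_def)
  have sep: "norm (w k - w' k) powr \<alpha> \<le> (W n * exp \<theta>) powr \<alpha> * \<delta> powr \<alpha> * e k" for k
  proof -
    have "norm (w k - w' k) \<le> W n * exp \<theta> * norm (w n - w' n) * exp ((\<sigma> + \<theta>) * real_of_int \<bar>k - n\<bar>)"
    proof (rule perturbed_growth [of "\<lambda>k. w k - w' k" "\<lambda>k. f k (w k) - f k (w' k)"])
      show "w (k + 1) - w' (k + 1) = A k (w k - w' k) + (f k (w k) - f k (w' k))" for k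
        by (simp add: w w' perturbed_def linear_diff bounded_linear.linear [OF linear_A])
    qed (rule f_Lip c)+
    then have "norm (w k - w' k) powr \<alpha> \<le>
        (W n * exp \<theta> * \<delta> * exp ((\<sigma> + \<theta>) * real_of_int \<bar>k - n\<bar>)) powr \<alpha>"
      using \<alpha> by (intro powr_mono2) (auto simp: w_def w'_def \<delta>_def)
    also have "\<dots> = (W n * exp \<theta>) powr \<alpha> * \<delta> powr \<alpha> * e k"
      using W_ge_1 [of n]
      by (simp add: powr_mult \<delta>_def e_def mu(1) exp_powr_real mult_ac)
    finally show ?thesis .
  qed
  \<comment> \<open>The contribution of \<open>w k - w' k\<close> to the forcing, through either perturbation.\<close>
  have saturate: "norm (h k a - h k b) \<le> E / 2 * e k"
    if "\<And>n x. norm (h n x) \<le> M" "\<And>n x y. norm (h n x - h n y) \<le> inverse (W (n + 1)) * c * norm (x - y)"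
      "a - b = w k - w' k" for h :: "int \<Rightarrow> 'a \<Rightarrow> 'a" and k a b
  proof -
    have "norm (h k a - h k b) \<le> 2 * M"
      using norm_triangle_ineq4 [of "h k a" "h k b"] that(1) [of k a] that(1) [of k b] by linarith
    moreover have "norm (h k a - h k b) \<le> c * norm (w k - w' k)"
      using that(2) [of k a b] weak [of k "a - b"] that(3) by simp
    then have "norm (h k a - h k b) \<le> norm (w k - w' k)"
      using c mult_right_mono [of c 1 "norm (w k - w' k)"] by simp
    ultimately have "norm (h k a - h k b) \<le> 2 * M * norm (w k - w' k) powr \<alpha>"
      using M \<alpha> by (intro le_powr_of_bounds) auto
    also have "\<dots> \<le> 2 * M * ((W n * exp \<theta>) powr \<alpha> * \<delta> powr \<alpha> * e k)"
      using M by (intro mult_left_mono sep) auto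
    also have "\<dots> = E / 2 * e k" by (simp add: E_def)
    finally show ?thesis .
  qed
  define d where "d k = (H k (w k) - w k) - (H k (w' k) - w' k)" for k
  define h where "h k = (g k (H k (w k)) - f k (w k)) - (g k (H k (w' k)) - f k (w' k))" for k
  have d: "bsol h d"
    unfolding h_def d_def by (intro bsol_diff semiconj_bsol [OF H] w w')
  have h_le: "norm (h k) \<le> E * e k + c * norm (d k)" for k
  proof -
    let ?z = "H k (w k) - w k"
    have triangle: "norm (p + q - r) \<le> norm p + norm q + norm r" for p q r :: 'a
      using norm_triangle_ineq4 [of "p + q" r] norm_triangle_ineq [of p q] by linarith
    have h_eq: "h k = (g k (w k + ?z) - g k (w' k + ?z)) + (g k (w' k + ?z) - g k (H k (w' k)))
        - (f k (w k) - f k (w' k))"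
      by (simp add: h_def)
    have "norm (h k) \<le> norm (g k (w k + ?z) - g k (w' k + ?z))
        + norm (g k (w' k + ?z) - g k (H k (w' k))) + norm (f k (w k) - f k (w' k))"
      unfolding h_eq by (rule triangle)
    also have "\<dots> \<le> E / 2 * e k + c * norm (d k) + E / 2 * e k"
    proof (intro add_mono)
      show "norm (g k (w k + ?z) - g k (w' k + ?z)) \<le> E / 2 * e k"
        by (rule saturate [OF gM g_Lip]) simp
      show "norm (f k (w k) - f k (w' k)) \<le> E / 2 * e k"
        by (rule saturate [OF fM f_Lip]) simp
      have "w' k + ?z - H k (w' k) = d k" by (simp add: d_def)
      then show "norm (g k (w' k + ?z) - g k (H k (w' k))) \<le> c * norm (d k)"
        using g_Lip [of k "w' k + ?z" "H k (w' k)"] weak [of k "d k"] by simp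
    qed
    finally show ?thesis by simp
  qed
  have h_bdd: "bounded (range h)"
  proof -
    have "norm (h k) \<le> 4 * M" for k
      unfolding h_def
      using norm_triangle_ineq4 [of "g k (H k (w k)) - f k (w k)" "g k (H k (w' k)) - f k (w' k)"]
        norm_triangle_ineq4 [of "g k (H k (w k))" "f k (w k)"]
        norm_triangle_ineq4 [of "g k (H k (w' k))" "f k (w' k)"]
        fM [of k "w k"] fM [of k "w' k"] gM [of k "H k (w k)"] gM [of k "H k (w' k)"]
      by linarith
    then show ?thesis by (auto simp: bounded_iff)
  qed
  \<comment> \<open>As \<open>d\<close> is bounded, this supremum is finite, and the estimate of \<open>N\<close>
    by a constant plus \<open>N / 2\<close> can be solved for \<open>N\<close>.\<close>
  define N where "N = (SUP k. norm (d k) / e k)"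
  from d obtain R where R: "\<And>k. norm (d k) \<le> R" by (auto simp: bsol_def bounded_iff)
  have "norm (d k) / e k \<le> R" for k
  proof -
    have "1 \<le> e k" using mu by (simp add: e_def)
    then have "norm (d k) / e k \<le> norm (d k) / 1" by (intro divide_left_mono) auto
    with R [of k] show ?thesis by simp
  qed
  then have "bdd_above (range (\<lambda>k. norm (d k) / e k))" by (auto simp: bdd_above_def)
  then have "norm (d k) / e k \<le> N" for k unfolding N_def by (intro cSUP_upper) auto
  then have N: "norm (d k) \<le> N * e k" for k using e_pos [of k] by (simp add: divide_le_eq)
  have d_le: "norm (d k) \<le> kappa \<mu> * (E + c * N) * e k" for k
    unfolding e_def
  proof (rule bsol_bound [OF d h_bdd _ mu(2,3)])
    fix k
    have "norm (h k) \<le> E * e k + c * (N * e k)"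
      using mult_left_mono [OF N c(1), of k] h_le [of k] by linarith
    then show "norm (h k) \<le> (E + c * N) * exp (\<mu> * real_of_int \<bar>k - n\<bar>)"
      by (simp add: e_def algebra_simps)
  qed
  have "N \<le> kappa \<mu> * (E + c * N)"
    unfolding N_def using d_le e_pos
    by (intro cSUP_least) (auto simp: divide_le_eq simp flip: N_def)
  moreover have "c * kappa \<mu> * N \<le> 1 / 2 * N"
  proof (rule mult_right_mono [OF small])
    show "0 \<le> N" using N [of n] order_trans [OF norm_ge_zero N [of n]] by (simp add: e_def)
  qed
  ultimately have "N \<le> 2 * kappa \<mu> * E" by (simp add: algebra_simps)
  then have "norm (d n) \<le> 2 * kappa \<mu> * E" using N [of n] by (simp add: e_def)
  then show ?thesis by (simp add: d_def w_def w'_def E_def \<delta>_def mult_ac)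
qed

end

section \<open>The conjugacies of the linear cocycle\<close>

lemma bounded_of_SUP_sup_norm:
  assumes "(SUP n. sup_norm (g n)) < \<infinity>"
  shows "\<exists>M. \<forall>n x. norm (g n x) \<le> M"
proof -
  from assms obtain M where M: "0 \<le> M" "(SUP n. sup_norm (g n)) = ennreal M"
    by (cases "SUP n. sup_norm (g n)" rule: ennreal_cases) auto
  have "norm (g n x) \<le> M" for n x
  proof -
    have "ennreal (norm (g n x)) \<le> sup_norm (g n)" unfolding sup_norm_def by (intro SUP_upper) simp
    also have "\<dots> \<le> ennreal M" unfolding M(2) [symmetric] by (intro SUP_upper) simp
    finally show ?thesis using M(1) by simp
  qed
  then show ?thesis by blast
qed

lemma SUP_sup_norm_finite:
  assumes "\<And>n x. norm (g n x) \<le> M"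
  shows "(SUP n. sup_norm (g n)) < \<infinity>"
proof -
  have "(SUP n. sup_norm (g n)) \<le> ennreal M"
    unfolding sup_norm_def by (intro SUP_least ennreal_leI assms)
  also have "\<dots> < \<infinity>" by simp
  finally show ?thesis .
qed

text \<open>Far from the origin \<open>ln (C m n) \<le> \<epsilon> * \<bar>m\<bar>\<close>, which differs from \<open>\<epsilon> * \<bar>m - n\<bar>\<close> by at most
  \<open>\<epsilon> * \<bar>n\<bar>\<close>; only finitely many \<open>m\<close> remain.\<close>

lemma subexponential_bdd_above:
  fixes C :: "int \<Rightarrow> int \<Rightarrow> real"
  assumes C_ge: "\<And>m n. C m n \<ge> 1"
    and top: "((\<lambda>m. ln (C m n) / real_of_int m) \<longlongrightarrow> 0) at_top"
    and bot: "((\<lambda>m. ln (C m n) / real_of_int m) \<longlongrightarrow> 0) at_bot"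
    and eps: "\<epsilon> > 0"
  shows "bdd_above (range (\<lambda>m. C m n * exp (- \<epsilon> * real_of_int \<bar>m - n\<bar>)))"
proof -
  let ?t = "\<lambda>m. C m n * exp (- \<epsilon> * real_of_int \<bar>m - n\<bar>)"
  have decay: "?t m \<le> exp (\<epsilon> * \<bar>n\<bar>)" if "ln (C m n) \<le> \<epsilon> * \<bar>m\<bar>" for m
  proof -
    have "?t m = exp (ln (C m n) - \<epsilon> * real_of_int \<bar>m - n\<bar>)"
      using C_ge [of m n] by (simp add: exp_diff exp_minus field_simps)
    also have "\<dots> \<le> exp (\<epsilon> * \<bar>m\<bar> - \<epsilon> * real_of_int \<bar>m - n\<bar>)" using that by simp
    also have "\<dots> \<le> exp (\<epsilon> * \<bar>n\<bar>)"
    proof -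
      have "\<epsilon> * real_of_int \<bar>m\<bar> \<le> \<epsilon> * (real_of_int \<bar>m - n\<bar> + real_of_int \<bar>n\<bar>)"
        using eps by (intro mult_left_mono) auto
      then show ?thesis by (simp add: algebra_simps)
    qed
    finally show ?thesis .
  qed
  have "\<forall>\<^sub>F m in at_top. \<bar>ln (C m n) / real_of_int m\<bar> < \<epsilon>"
    using tendstoD [OF top eps] by (simp add: dist_real_def)
  then obtain a where a: "\<And>m. a \<le> m \<Longrightarrow> \<bar>ln (C m n) / real_of_int m\<bar> < \<epsilon>"
    by (auto simp: eventually_at_top_linorder)
  have "\<forall>\<^sub>F m in at_bot. \<bar>ln (C m n) / real_of_int m\<bar> < \<epsilon>"
    using tendstoD [OF bot eps] by (simp add: dist_real_def)
  then obtain b where b: "\<And>m. m \<le> b \<Longrightarrow> \<bar>ln (C m n) / real_of_int m\<bar> < \<epsilon>"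
    by (auto simp: eventually_at_bot_linorder)
  have far: "?t m \<le> exp (\<epsilon> * \<bar>n\<bar>)" if "m \<notin> {min b (-1)..max a 1}" for m
  proof (rule decay)
    from that have "m \<noteq> 0" "\<bar>ln (C m n) / real_of_int m\<bar> < \<epsilon>" using a [of m] b [of m] by auto
    then show "ln (C m n) \<le> \<epsilon> * real_of_int \<bar>m\<bar>" by (simp add: abs_divide divide_less_eq)
  qed
  have "range ?t \<subseteq> ?t ` {min b (-1)..max a 1} \<union> {..exp (\<epsilon> * \<bar>n\<bar>)}"
    using far by blast
  moreover have "bdd_above (?t ` {min b (-1)..max a 1} \<union> {..exp (\<epsilon> * \<bar>n\<bar>)})"
    by (intro bdd_above_Un [THEN iffD2] conjI bdd_above_finite bdd_above_Iic) auto
  ultimately show ?thesis by (rule bdd_above_mono [rotated])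
qed

context dichotomy begin

lemma conjugacy_iff_semiconj:
  "conjugacy A S U f H \<longleftrightarrow>
    semiconj (\<lambda>_ _. 0) f H \<and> (\<forall>n. homeomorphic_map euclidean euclidean (H n))"
proof
  assume conj: "conjugacy A S U f H"
  then have "(SUP n. sup_norm (\<lambda>x. H n x - x)) < \<infinity>" by (simp add: conjugacy_def)
  from bounded_of_SUP_sup_norm [OF this] obtain M where "\<forall>n x. norm (H n x - x) \<le> M" by blast
  with conj show "semiconj (\<lambda>_ _. 0) f H \<and> (\<forall>n. homeomorphic_map euclidean euclidean (H n))"
    by (auto simp: conjugacy_def semiconj_def perturbed_def Z_def fun_eq_iff)
next
  assume *: "semiconj (\<lambda>_ _. 0) f H \<and> (\<forall>n. homeomorphic_map euclidean euclidean (H n))"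
  then obtain M where "\<forall>n x. norm (H n x - x) \<le> M" unfolding semiconj_def by blast
  then have "(SUP n. sup_norm (\<lambda>x. H n x - x)) < \<infinity>" by (intro SUP_sup_norm_finite) blast
  with * show "conjugacy A S U f H"
    by (auto simp: conjugacy_def semiconj_def perturbed_def Z_def fun_eq_iff)
qed

end

theorem theorem2:
  fixes A :: "int \<Rightarrow> 'a::banach \<Rightarrow> 'a"
    and S U :: "int \<Rightarrow> 'a set"
    and C :: "int \<Rightarrow> int \<Rightarrow> real"
    and lam \<rho> \<alpha> \<epsilon> :: real
  assumes inv_A: "\<And>n. invertible_op (A n)"
    and dich: "gen_exp_dichotomy A S U lam"
    and rho: "\<rho> > 0"
    and C_ge: "\<And>m n. C m n \<ge> 1"
    and C_top: "\<And>n. ((\<lambda>m. ln (C m n) / real_of_int m) \<longlongrightarrow> 0) at_top"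
    and C_bot: "\<And>n. ((\<lambda>m. ln (C m n) / real_of_int m) \<longlongrightarrow> 0) at_bot"
    and growth: "\<And>m n x. norm (cocycle A m n x) \<le> C m n * exp (\<rho> * real_of_int \<bar>m - n\<bar>) * norm x"
    and alpha: "0 < \<alpha>" "\<alpha> < lam / \<rho>"
    and alpha_le: "\<alpha> \<le> 1"
    and eps: "\<epsilon> > 0" "\<alpha> * (\<rho> + \<epsilon>) < lam"
  shows "(\<forall>n. bdd_above (range (\<lambda>m. C m n * exp (- \<epsilon> * real_of_int \<bar>m - n\<bar>)))) \<and>
    (\<exists>c0>0. \<forall>c f. 0 < c \<and> c < c0 \<and>
        (\<forall>n. homeomorphic_map euclidean euclidean (\<lambda>x. A n x + f n x)) \<and>
        (SUP n. sup_norm (f n)) < \<infinity> \<and>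
        (\<forall>n x y. norm (f n x - f n y) \<le> inverse (weight_sup C \<epsilon> (n + 1)) * c * norm (x - y))
      \<longrightarrow> (\<exists>!H. conjugacy A S U f H) \<and>
          (\<forall>H. conjugacy A S U f H \<longrightarrow>
             (\<forall>n B. bounded B \<longrightarrow> holder_on \<alpha> B (H n) \<and> holder_on \<alpha> B (inv (H n)))))"
proof
  let ?W = "weight_sup C \<epsilon>"
  have bdd: "bdd_above (range (\<lambda>m. C m n * exp (- \<epsilon> * real_of_int \<bar>m - n\<bar>)))" for n
    by (rule subexponential_bdd_above [OF C_ge C_top C_bot eps(1)])
  then show "\<forall>n. bdd_above (range (\<lambda>m. C m n * exp (- \<epsilon> * real_of_int \<bar>m - n\<bar>)))" by blast
  have W: "C m n * exp (- \<epsilon> * real_of_int \<bar>m - n\<bar>) \<le> ?W n" for m n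
    unfolding weight_sup_def by (rule cSUP_upper [OF UNIV_I bdd])
  from dich have
      split: "closed_direct_sum (S n) (U n)" and lam: "lam > 0"
      and AS: "A n ` S n \<subseteq> S (n + 1)" and AU: "inv (A n) ` U (n + 1) \<subseteq> U n" for n
    unfolding gen_exp_dichotomy_def by blast+
  from dich obtain D where D: "D > 0" and contracts:
      "\<forall>m n x. x \<in> S n \<and> n \<le> m \<longrightarrow> norm (cocycle A m n x) \<le> D * exp (- lam * real_of_int (m - n)) * norm x"
      "\<forall>m n x. x \<in> U n \<and> m \<le> n \<longrightarrow> norm (cocycle A m n x) \<le> D * exp (- lam * real_of_int (n - m)) * norm x"
    unfolding gen_exp_dichotomy_def by (elim conjE exE)
  from dich obtain K where K: "\<forall>n x. norm (proj_along (S n) (U n) x) \<le> K * norm x"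
    unfolding gen_exp_dichotomy_def by (elim conjE exE)
  have K': "norm (proj_along (S n) (U n) x) \<le> max 0 K * norm x" for n x
    by (rule order_trans [OF K [rule_format]]) (simp add: mult_right_mono)
  interpret dichotomy A S U lam D "max 0 K"
    by unfold_locales (fact inv_A split AS AU lam D K' max.cobounded1 contracts [rule_format, OF conjI])+
  interpret weighted_dichotomy A S U lam D "max 0 K" ?W "\<rho> + \<epsilon>"
  proof
    show "1 \<le> ?W n" for n using W [of n n] C_ge [of n n] by simp
    show "0 \<le> \<rho> + \<epsilon>" using rho eps by simp
    show "norm (cocycle A m n x) \<le> ?W n * exp ((\<rho> + \<epsilon>) * real_of_int \<bar>m - n\<bar>) * norm x" for m n x
    proof (rule order_trans [OF growth], rule mult_right_mono)
      have "C m n \<le> ?W n * exp (\<epsilon> * real_of_int \<bar>m - n\<bar>)"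
        using W [of m n] by (simp add: exp_minus field_simps)
      then have "C m n * exp (\<rho> * real_of_int \<bar>m - n\<bar>) \<le>
          ?W n * exp (\<epsilon> * real_of_int \<bar>m - n\<bar>) * exp (\<rho> * real_of_int \<bar>m - n\<bar>)"
        by (rule mult_right_mono) simp
      then show "C m n * exp (\<rho> * real_of_int \<bar>m - n\<bar>) \<le> ?W n * exp ((\<rho> + \<epsilon>) * real_of_int \<bar>m - n\<bar>)"
        by (simp add: algebra_simps exp_add)
    qed simp
  qed
  \<comment> \<open>The midpoint of the available gap: \<open>\<mu>\<close> below is halfway between \<open>\<alpha> * (\<rho> + \<epsilon>)\<close> and \<open>lam\<close>.\<close>
  define \<theta> where "\<theta> = (lam / \<alpha> - (\<rho> + \<epsilon>)) / 2"
  define \<mu> where "\<mu> = \<alpha> * ((\<rho> + \<epsilon>) + \<theta>)"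
  have \<theta>: "0 < \<theta>" using eps alpha by (simp add: \<theta>_def field_simps)
  have "\<mu> = (\<alpha> * (\<rho> + \<epsilon>) + lam) / 2"
    using alpha by (simp add: \<mu>_def \<theta>_def field_simps)
  moreover have "0 < \<alpha> * (\<rho> + \<epsilon>)" using alpha rho eps by simp
  ultimately have \<mu>: "0 \<le> \<mu>" "\<mu> < lam" using eps(2) by auto
  \<comment> \<open>The four bounds serve interpolation, separation of orbits, the contraction principle and
    the absorption in the Hoelder estimate.\<close>
  define c0 where "c0 = Min {1, (1 - exp (- \<theta>)) / exp (\<rho> + \<epsilon>), 1 / (2 * kappa 0), 1 / (2 * kappa \<mu>)}"
  have kappa: "0 < kappa 0" "0 < kappa \<mu>" using kappa_pos lam_pos \<mu> by auto
  show "\<exists>c0>0. \<forall>c f. 0 < c \<and> c < c0 \<and>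
        (\<forall>n. homeomorphic_map euclidean euclidean (\<lambda>x. A n x + f n x)) \<and>
        (SUP n. sup_norm (f n)) < \<infinity> \<and>
        (\<forall>n x y. norm (f n x - f n y) \<le> inverse (?W (n + 1)) * c * norm (x - y))
      \<longrightarrow> (\<exists>!H. conjugacy A S U f H) \<and>
          (\<forall>H. conjugacy A S U f H \<longrightarrow>
             (\<forall>n B. bounded B \<longrightarrow> holder_on \<alpha> B (H n) \<and> holder_on \<alpha> B (inv (H n))))"
  proof (intro exI [of _ c0] conjI [of "c0 > 0"] allI impI; (elim conjE)?)
    show "c0 > 0" using kappa \<theta> by (simp add: c0_def)
  next
    fix c :: real and f
    assume c: "0 < c" "c < c0" and homeo: "\<forall>n. homeomorphic_map euclidean euclidean (\<lambda>x. A n x + f n x)"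
      and f_fin: "(SUP n. sup_norm (f n)) < \<infinity>"
      and f_Lip: "\<forall>n x y. norm (f n x - f n y) \<le> inverse (?W (n + 1)) * c * norm (x - y)"
    have c1: "c \<le> 1" and c2: "c * exp (\<rho> + \<epsilon>) \<le> 1 - exp (- \<theta>)"
      and c3: "c * kappa 0 < 1" and c4: "c * kappa \<mu> \<le> 1 / 2"
      using c kappa by (auto simp: c0_def field_simps)
    obtain M0 where M0: "\<forall>n x. norm (f n x) \<le> M0"
      using bounded_of_SUP_sup_norm [OF f_fin] by blast
    \<comment> \<open>The interpolation between the bound and the Lipschitz condition needs a bound of at least 1.\<close>
    define M where "M = max 1 M0"
    \<comment> \<open>Both the given perturbation and the zero perturbation satisfy \<open>?adm\<close>, so that the
      conjugacy and its inverse are treated alike.\<close>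
    let ?adm = "\<lambda>g. (\<forall>n. bij (perturbed g n)) \<and> (\<forall>n x. norm (g n x) \<le> M) \<and>
      (\<forall>n x y. norm (g n x - g n y) \<le> inverse (?W (n + 1)) * c * norm (x - y))"
    let ?zero = "\<lambda>(_::int) (_::'a). 0::'a"
    have "bij (perturbed f n)" for n
      using homeomorphic_imp_surjective_map [OF homeo [rule_format, of n]]
        homeomorphic_imp_injective_map [OF homeo [rule_format, of n]]
      by (simp add: perturbed_def [abs_def] bij_def)
    moreover have "norm (f n x) \<le> M" for n x
      unfolding M_def by (rule order_trans [OF M0 [rule_format] max.cobounded2])
    ultimately have f_adm: "?adm f" using f_Lip by blast
    have zero_adm: "?adm ?zero"
    proof -
      have "0 \<le> inverse (?W n) * c" for n
        using W_ge_1 [of n] c(1) by (intro mult_nonneg_nonneg) auto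
      then show ?thesis using bij_A by (simp add: M_def perturbed_def [abs_def])
    qed
    have ex1: "\<exists>!H. semiconj g h H" if "?adm g" "?adm h" for g h
    proof (rule semiconj_ex1 [of g M h c])
      fix n and x y :: 'a
      have "inverse (?W (n + 1)) * (c * norm (x - y)) \<le> 1 * (c * norm (x - y))"
        using W_ge_1 [of "n + 1"] c(1) by (intro mult_right_mono) (auto simp: inverse_le_1_iff)
      moreover have "norm (h n x - h n y) \<le> inverse (?W (n + 1)) * c * norm (x - y)"
        using that(2) by blast
      ultimately show "norm (h n x - h n y) \<le> c * norm (x - y)" by (simp add: mult.assoc)
    qed (use that c c3 in auto)
    have holder: "holder_on \<alpha> B (H n)" if "?adm g" "?adm h" "semiconj g h H" "bounded B" for g h H n B
      using semiconj_displacement_holder [OF that(3), of M c \<theta> \<alpha> \<mu>] that(1,2) c(1) c1 c2 c4 \<mu> alpha alpha_le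
      by (intro holder_on_bounded [OF _ alpha(1) alpha_le that(4)]) (auto simp: M_def \<mu>_def)
    obtain G where G: "semiconj f ?zero G" using ex1 [OF f_adm zero_adm] by blast
    have inverses: "G n (H n x) = x" "H n (G n x) = x" if "semiconj ?zero f H" for H n x
      using semiconj_inverse [OF that G ex1 [OF zero_adm zero_adm]]
        semiconj_inverse [OF G that ex1 [OF f_adm f_adm]] by auto
    have homeo_H: "homeomorphic_map euclidean euclidean (H n)" if H: "semiconj ?zero f H" for H n
    proof -
      have "continuous_on UNIV (H n)"
        by (rule continuous_on_of_holder [OF holder [OF zero_adm f_adm H] alpha(1)])
      moreover have "continuous_on UNIV (G n)"
        by (rule continuous_on_of_holder [OF holder [OF f_adm zero_adm G] alpha(1)])
      ultimately have "homeomorphic_maps euclidean euclidean (H n) (G n)"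
        by (simp add: homeomorphic_maps_def inverses [OF H])
      then show ?thesis by (auto simp: homeomorphic_map_maps)
    qed
    then have conj: "conjugacy A S U f H \<longleftrightarrow> semiconj ?zero f H" for H
      using conjugacy_iff_semiconj by blast
    have "holder_on \<alpha> B (H n) \<and> holder_on \<alpha> B (inv (H n))"
      if "conjugacy A S U f H" and B: "bounded B" for H n and B :: "'a set"
    proof
      have H: "semiconj ?zero f H" using that(1) by (simp add: conj)
      show "holder_on \<alpha> B (H n)" by (rule holder [OF zero_adm f_adm H B])
      have "inv (H n) = G n" by (rule inv_equality) (simp_all add: inverses [OF H])
      then show "holder_on \<alpha> B (inv (H n))" using holder [OF f_adm zero_adm G B] by simp
    qed
    moreover have "\<exists>!H. conjugacy A S U f H" unfolding conj by (rule ex1 [OF zero_adm f_adm])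
    ultimately show "(\<exists>!H. conjugacy A S U f H) \<and>
        (\<forall>H. conjugacy A S U f H \<longrightarrow>
          (\<forall>n B. bounded B \<longrightarrow> holder_on \<alpha> B (H n) \<and> holder_on \<alpha> B (inv (H n))))"
      by blast
  qed
qed

end
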